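(* Let $\mathcal{A},\mathcal{B}\in\mathbb{C}^{I_1\times\cdots\times I_N\times I_1\times\cdots\times I_N}$, and let $\mathcal{M},\mathcal{N}\in\mathbb{C}^{I_1\times\cdots\times I_N\times I_1\times\cdots\times I_N}$ be Hermitian positive definite tensors. Suppose $\mathcal{M}*_N\mathcal{A}^{\dagger}_{\mathcal{M}\mathcal{N}}=(\mathcal{M}*_N\mathcal{A})^H$ and $\mathcal{N}*_N\mathcal{B}^{\dagger}_{\mathcal{M}\mathcal{N}}=(\mathcal{N}*_N\mathcal{B})^H$. If at least one of the following four equations holds: $$\mathcal{A}*_N(\mathcal{B}*_N\mathcal{B}^{\dagger}_{\mathcal{M}\mathcal{N}})=(\mathcal{B}*_N\mathcal{B}^{\dagger}_{\mathcal{M}\mathcal{N}})*_N\mathcal{A},$$ $$\mathcal{A}^{\dagger}_{\mathcal{M}\mathcal{N}}*_N(\mathcal{B}*_N\mathcal{B}^{\dagger}_{\mathcal{M}\mathcal{N}})=(\mathcal{B}*_N\mathcal{B}^{\dagger}_{\mathcal{M}\mathcal{N}})*_N\mathcal{A}^{\dagger}_{\mathcal{M}\mathcal{N}},$$ $$\mathcal{B}*_N(\mathcal{A}^{\dagger}_{\mathcal{M}\mathcal{N}}*_N\mathcal{A})=(\mathcal{A}^{\dagger}_{\mathcal{M}\mathcal{N}}*_N\mathcal{A})*_N\mathcal{B},$$ $$\mathcal{B}^{\dagger}_{\mathcal{M}\mathcal{N}}*_N(\mathcal{A}^{\dagger}_{\mathcal{M}\mathcal{N}}*_N\mathcal{A})=(\mathcal{A}^{\dagger}_{\mathcal{M}\mathcal{N}}*_N\mathcal{A})*_N\mathcal{B}^{\dagger}_{\mathcal{M}\mathcal{N}},$$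 then $(\mathcal{A}*_N\mathcal{B})^{\dagger}_{\mathcal{M}\mathcal{N}}=\mathcal{B}^{\dagger}_{\mathcal{M}\mathcal{N}}*_N\mathcal{A}^{\dagger}_{\mathcal{M}\mathcal{N}}$.
   Context: For tensors $\mathcal{A},\mathcal{B}\in\mathbb{C}^{I_1\times\cdots\times I_N\times I_1\times\cdots\times I_N}$ the Einstein product is $(\mathcal{A}*_N\mathcal{B})_{i_1\cdots i_Nk_1\cdots k_N}=\sum_{j_1,\dots,j_N}a_{i_1\cdots i_Nj_1\cdots j_N}b_{j_1\cdots j_Nk_1\cdots k_N}$. The conjugate transpose is $(\mathcal{A}^H)_{j_1\cdots j_Ni_1\cdots i_N}=\overline{a_{i_1\cdots i_Nj_1\cdots j_N}}$. The identity tensor $\mathcal{I}$ has entries $\prod_{k}\delta_{i_kj_k}$; $\mathcal{U}$ is unitary if $\mathcal{U}*_N\mathcal{U}^H=\mathcal{U}^H*_N\mathcal{U}=\mathcal{I}$; $\mathcal{D}$ is diagonal if $d_{i_1\cdots i_Nj_1\cdots j_N}=0$ whenever $(i_1,\dots,i_N)\ne(j_1,\dots,j_N)$. A tensor $\mathcal{P}$ is Hermitian positive definite if $\mathcal{P}=\mathcal{U}*_N\mathcal{D}*_N\mathcal{U}^H$ with $\mathcal{U}$ unitary and $\mathcal{D}$ diagonal with positive diagonal entries. For Hermitian positive definite $\mathcal{M},\mathcal{N}$, the weighted Moore--Penrose inverse $\mathcal{A}^{\dagger}_{\mathcal{M}\mathcal{N}}$ is the unique tensor $\mathcal{X}\in\mathbb{C}^{I_1\times\cdots\times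 I_N\times I_1\times\cdots\times I_N}$ satisfying $\mathcal{A}*_N\mathcal{X}*_N\mathcal{A}=\mathcal{A}$, $\mathcal{X}*_N\mathcal{A}*_N\mathcal{X}=\mathcal{X}$, $(\mathcal{M}*_N\mathcal{A}*_N\mathcal{X})^H=\mathcal{M}*_N\mathcal{A}*_N\mathcal{X}$, $(\mathcal{N}*_N\mathcal{X}*_N\mathcal{A})^H=\mathcal{N}*_N\mathcal{X}*_N\mathcal{A}$. *)

theory Defs
  imports Complex_Main
begin

text \<open>
  Square tensors in $\mathbb{C}^{I_1 \times \cdots \times I_N \times I_1 \times \cdots \times I_N}$.
  The list \<open>I = [I\<^sub>1, \<dots>, I\<^sub>N]\<close> carries both the dimensions and \<open>N = length I\<close>.  A multi-index
  \<open>(i\<^sub>1, \<dots>, i\<^sub>N)\<close> with \<open>1 \<le> i\<^sub>k \<le> I\<^sub>k\<close> is a list of length \<open>N\<close>; its entry \<open>i\<^sub>k\<close> is \<open>i ! (k - 1)\<close>.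
\<close>

type_synonym ctensor = "nat list \<Rightarrow> nat list \<Rightarrow> complex"

definition multi_index :: "nat list \<Rightarrow> nat list set" where
  "multi_index I = {i. length i = length I \<and> (\<forall>k<length I. 1 \<le> i ! k \<and> i ! k \<le> I ! k)}"

text \<open>
  A tensor is stored as a total function that is zero off the index range, so that HOL equality
  of members of \<open>tensors I\<close> is entrywise equality.
\<close>

definition tensors :: "nat list \<Rightarrow> ctensor set" where
  "tensors I = {A. \<forall>i j. i \<notin> multi_index I \<or> j \<notin> multi_index I \<longrightarrow> A i j = 0}"

definition einstein_prod :: "nat list \<Rightarrow> ctensor \<Rightarrow> ctensor \<Rightarrow> ctensor"  (infixl "\<star>\<index>" 70) where
  "A \<star>\<^bsub>I\<^esub> B = (\<lambda>i k. \<Sum>j\<in>multi_index I. A i j * B j k)"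

definition conj_transpose :: "ctensor \<Rightarrow> ctensor"  ("_\<^sup>H" [1000] 999) where
  "A\<^sup>H = (\<lambda>j i. cnj (A i j))"

definition id_tensor :: "nat list \<Rightarrow> ctensor" where
  "id_tensor I = (\<lambda>i j. if i \<in> multi_index I \<and> j \<in> multi_index I
     then (\<Prod>k<length I. if i ! k = j ! k then 1 else 0) else 0)"

definition unitary_tensor :: "nat list \<Rightarrow> ctensor \<Rightarrow> bool" where
  "unitary_tensor I U \<longleftrightarrow> U \<in> tensors I \<and>
     U \<star>\<^bsub>I\<^esub> U\<^sup>H = id_tensor I \<and> U\<^sup>H \<star>\<^bsub>I\<^esub> U = id_tensor I"

definition diagonal_tensor :: "nat list \<Rightarrow> ctensor \<Rightarrow> bool" where
  "diagonal_tensor I D \<longleftrightarrow> D \<in> tensors I \<and>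
     (\<forall>i\<in>multi_index I. \<forall>j\<in>multi_index I. i \<noteq> j \<longrightarrow> D i j = 0)"

definition hermitian_pos_def :: "nat list \<Rightarrow> ctensor \<Rightarrow> bool" where
  "hermitian_pos_def I P \<longleftrightarrow> (\<exists>U D. unitary_tensor I U \<and> diagonal_tensor I D \<and>
     (\<forall>i\<in>multi_index I. D i i \<in> \<real> \<and> 0 < Re (D i i)) \<and>
     P = U \<star>\<^bsub>I\<^esub> D \<star>\<^bsub>I\<^esub> U\<^sup>H)"

definition is_wmp_inverse ::
  "nat list \<Rightarrow> ctensor \<Rightarrow> ctensor \<Rightarrow> ctensor \<Rightarrow> ctensor \<Rightarrow> bool" where
  "is_wmp_inverse I M N A X \<longleftrightarrow> X \<in> tensors I \<and>
     A \<star>\<^bsub>I\<^esub> X \<star>\<^bsub>I\<^esub> A = A \<and>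
     X \<star>\<^bsub>I\<^esub> A \<star>\<^bsub>I\<^esub> X = X \<and>
     (M \<star>\<^bsub>I\<^esub> A \<star>\<^bsub>I\<^esub> X)\<^sup>H = M \<star>\<^bsub>I\<^esub> A \<star>\<^bsub>I\<^esub> X \<and>
     (N \<star>\<^bsub>I\<^esub> X \<star>\<^bsub>I\<^esub> A)\<^sup>H = N \<star>\<^bsub>I\<^esub> X \<star>\<^bsub>I\<^esub> A"

text \<open>
  The weighted Moore--Penrose inverse of \<open>A\<close> with weights \<open>M\<close>, \<open>N\<close>; only meaningful when the four
  equations have exactly one solution, as they do for Hermitian positive definite \<open>M\<close>, \<open>N\<close>.
\<close>

definition wmp_inverse :: "nat list \<Rightarrow> ctensor \<Rightarrow> ctensor \<Rightarrow> ctensor \<Rightarrow> ctensor" where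
  "wmp_inverse I M N A = (THE X. is_wmp_inverse I M N A X)"

end

theory Submission
  imports Defs "HOL-Library.Function_Algebras"
begin

text \<open>
  Call \<open>S\<close> a \<open>W\<close>-adjoint of \<open>T\<close> when \<open>W S = T\<^sup>H W\<close>, so that the last two Penrose equations say that
  \<open>A X\<close> is \<open>M\<close>-selfadjoint and \<open>X A\<close> is \<open>N\<close>-selfadjoint.  The two hypotheses on \<open>X = A\<^sup>\<dagger>\<close> and
  \<open>Y = B\<^sup>\<dagger>\<close> say that \<open>X\<close> is the \<open>M\<close>-adjoint of \<open>A\<close> and \<open>Y\<close> the \<open>N\<close>-adjoint of \<open>B\<close>.  Hence \<open>P = X A\<close>
  and \<open>Q = B Y\<close> are selfadjoint for both weights, and so are \<open>A Q X\<close> for \<open>M\<close> and \<open>Y P B\<close> for \<open>N\<close>.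
  The remaining two Penrose equations for \<open>A B\<close> and \<open>Y X\<close> follow from \<open>P Q = Q P\<close>, and each of the
  four commutation conditions implies this when combined with its own adjoint.

  Since the inverse is given by a definite description, its existence has to be shown: if \<open>G\<close> is an
  inner inverse of \<open>A\<^sup>H M A\<close>, then \<open>Y = G A\<^sup>H M\<close> satisfies \<open>A Y A = A\<close> with \<open>A Y\<close> selfadjoint for \<open>M\<close>;
  dually there is \<open>Z\<close> with \<open>A Z A = A\<close> and \<open>Z A\<close> selfadjoint for \<open>N\<close>, and \<open>Z A Y\<close> is the inverse.
\<close>

section \<open>The algebra of square tensors\<close>

text \<open>Entries are bounded by the largest dimension and the length is fixed. Finiteness matters
  because HOL sums over infinite sets default to 0. The extra 0 under \<open>Max\<close> covers the
  empty list.\<close>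

lemma finite_multi_index: "finite (multi_index I)"
proof -
  let ?m = "Max (insert 0 (set I))"
  have "multi_index I \<subseteq> {i. set i \<subseteq> {..?m} \<and> length i = length I}"
  proof (intro subsetI CollectI conjI)
    fix i x assume i: "i \<in> multi_index I" and "x \<in> set i"
    then obtain k where "k < length i" "x = i ! k" by (auto simp: in_set_conv_nth)
    with i have "x \<le> I ! k" "k < length I" by (auto simp: multi_index_def)
    moreover from this have "I ! k \<le> ?m" by (intro Max_ge) auto
    ultimately show "x \<in> {..?m}" unfolding atMost_iff by linarith
  qed (auto simp: multi_index_def)
  then show ?thesis by (rule finite_subset) (simp add: finite_lists_length_eq)
qed

text \<open>Multi-indices have equal length, so distinct ones differ at some position, and the
  Kronecker factor there kills the product.\<close>

lemma id_tensor_eq: "id_tensor I i j = (if i = j \<and> i \<in> multi_index I then 1 else 0)"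
proof -
  have "(\<Prod>k<length I. if i ! k = j ! k then 1 else 0) = (0::complex)"
    if "i \<in> multi_index I" "j \<in> multi_index I" "i \<noteq> j"
  proof -
    from that obtain k where "k < length I" "i ! k \<noteq> j ! k"
      by (auto simp: multi_index_def list_eq_iff_nth_eq)
    then show ?thesis by (intro prod_zero) auto
  qed
  then show ?thesis by (auto simp: id_tensor_def)
qed

lemma prod_assoc: "A \<star>\<^bsub>I\<^esub> B \<star>\<^bsub>I\<^esub> C = A \<star>\<^bsub>I\<^esub> (B \<star>\<^bsub>I\<^esub> C)"
proof (intro ext)
  fix i k
  have "(A \<star>\<^bsub>I\<^esub> B \<star>\<^bsub>I\<^esub> C) i k = (\<Sum>j\<in>multi_index I. \<Sum>l\<in>multi_index I. A i l * B l j * C j k)"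
    by (simp add: einstein_prod_def sum_distrib_right)
  also have "\<dots> = (\<Sum>l\<in>multi_index I. \<Sum>j\<in>multi_index I. A i l * B l j * C j k)"
    by (rule sum.swap)
  also have "\<dots> = (A \<star>\<^bsub>I\<^esub> (B \<star>\<^bsub>I\<^esub> C)) i k"
    by (simp add: einstein_prod_def sum_distrib_left mult.assoc)
  finally show "(A \<star>\<^bsub>I\<^esub> B \<star>\<^bsub>I\<^esub> C) i k = (A \<star>\<^bsub>I\<^esub> (B \<star>\<^bsub>I\<^esub> C)) i k" .
qed

lemma prod_diff_right: "A \<star>\<^bsub>I\<^esub> (B - C) = A \<star>\<^bsub>I\<^esub> B - A \<star>\<^bsub>I\<^esub> C"
  by (simp add: einstein_prod_def fun_eq_iff right_diff_distrib sum_subtractf)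

lemma conj_transpose_prod: "(A \<star>\<^bsub>I\<^esub> B)\<^sup>H = B\<^sup>H \<star>\<^bsub>I\<^esub> A\<^sup>H"
  by (simp add: einstein_prod_def conj_transpose_def fun_eq_iff mult.commute)

lemma conj_transpose_conj_transpose [simp]: "(A\<^sup>H)\<^sup>H = A"
  by (simp add: conj_transpose_def)

lemma prod_in_tensors [intro]: "A \<in> tensors I \<Longrightarrow> B \<in> tensors I \<Longrightarrow> A \<star>\<^bsub>I\<^esub> B \<in> tensors I"
  by (auto simp: tensors_def einstein_prod_def)

lemma conj_transpose_in_tensors [intro]: "A \<in> tensors I \<Longrightarrow> A\<^sup>H \<in> tensors I"
  by (auto simp: tensors_def conj_transpose_def)

lemma diff_in_tensors [intro]: "A \<in> tensors I \<Longrightarrow> B \<in> tensors I \<Longrightarrow> A - B \<in> tensors I"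
  by (auto simp: tensors_def)

lemma id_prod:
  assumes "A \<in> tensors I"
  shows "id_tensor I \<star>\<^bsub>I\<^esub> A = A"
proof (intro ext)
  fix i k
  have "(id_tensor I \<star>\<^bsub>I\<^esub> A) i k = (\<Sum>j\<in>multi_index I. if j = i then A i k else 0)"
    unfolding einstein_prod_def by (intro sum.cong) (auto simp: id_tensor_eq)
  then show "(id_tensor I \<star>\<^bsub>I\<^esub> A) i k = A i k"
    using assms by (auto simp: finite_multi_index tensors_def)
qed

lemma conj_transpose_id: "(id_tensor I)\<^sup>H = id_tensor I"
  by (auto simp: conj_transpose_def id_tensor_eq fun_eq_iff)

lemma prod_id: "A \<in> tensors I \<Longrightarrow> A \<star>\<^bsub>I\<^esub> id_tensor I = A"
  using id_prod[of "A\<^sup>H" I]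
  by (metis conj_transpose_conj_transpose conj_transpose_id conj_transpose_in_tensors conj_transpose_prod)

section \<open>Inner inverses\<close>

lemma sum_fun_apply: "(\<Sum>j\<in>J. f j) x = (\<Sum>j\<in>J. f j x)"
  by (induction J rule: infinite_finite_induct) auto

text \<open>View \<open>A\<close> as a linear map \<open>f\<close> and choose a linear
  \<open>g\<close> that inverts \<open>f\<close> on its range, so that \<open>f g f = f\<close>. The
  matrix of \<open>g\<close> on the unit vectors is the desired \<open>G\<close>.\<close>

lemma inner_inverse_exists:
  assumes A: "A \<in> tensors I"
  obtains G where "G \<in> tensors I" and "A \<star>\<^bsub>I\<^esub> G \<star>\<^bsub>I\<^esub> A = A"
proof -
  define J where "J = multi_index I"
  have fin: "finite J" by (simp add: J_def finite_multi_index)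
  let ?s = "\<lambda>(c::complex) (v::nat list \<Rightarrow> complex) x. c * v x"
  interpret vs: vector_space ?s
    by unfold_locales (auto simp: fun_eq_iff algebra_simps)
  interpret vp: vector_space_pair ?s ?s by unfold_locales
  define f where "f = (\<lambda>(v::nat list \<Rightarrow> complex) i. \<Sum>j\<in>J. A i j * v j)"
  have "Vector_Spaces.linear ?s ?s f"
    by unfold_locales (auto simp: f_def fun_eq_iff algebra_simps sum.distrib sum_distrib_left)
  from vp.linear_exists_right_inverse_on[OF this vs.subspace_UNIV]
  obtain g where g: "Vector_Spaces.linear ?s ?s g" and fg: "\<And>v. f (g (f v)) = f v"
    by auto
  define e where "e = (\<lambda>j k::nat list. if k = j then 1 else 0 :: complex)"
  define G where "G = (\<lambda>i j. if i \<in> J \<and> j \<in> J then g (e j) i else 0)"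
  \<comment> \<open>The ambient space consists of all functions on lists and is
    infinite-dimensional; only vectors supported on the finite set \<open>J\<close> are combinations
    of the unit vectors \<open>e j\<close>.\<close>
  have expand: "g y i = (\<Sum>j\<in>J. g (e j) i * y j)" if y: "\<And>j. j \<notin> J \<Longrightarrow> y j = 0" for y i
  proof -
    have "y = (\<Sum>j\<in>J. ?s (y j) (e j))"
      using y by (auto simp: fun_eq_iff e_def sum_fun_apply fin if_distrib[of "\<lambda>x. _ * x"] cong: if_cong)
    then have "g y = g (\<Sum>j\<in>J. ?s (y j) (e j))" by simp
    also have "\<dots> = (\<Sum>j\<in>J. ?s (y j) (g (e j)))"
      using g by (simp add: vp.linear_sum vp.linear_scale)
    finally show ?thesis by (simp add: sum_fun_apply mult.commute)
  qed
  have "A \<star>\<^bsub>I\<^esub> (G \<star>\<^bsub>I\<^esub> A) = A"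
  proof (intro ext)
    fix i k
    let ?y = "\<lambda>j. A j k"
    have y: "?y j = 0" if "j \<notin> J" for j using A that by (auto simp: tensors_def J_def)
    show "(A \<star>\<^bsub>I\<^esub> (G \<star>\<^bsub>I\<^esub> A)) i k = A i k"
    proof (cases "k \<in> J")
      case False
      then show ?thesis using A by (auto simp: tensors_def J_def einstein_prod_def)
    next
      case True
      \<comment> \<open>Column \<open>k\<close> of \<open>A\<close> lies in the range of
        \<open>f\<close>, which is where \<open>g\<close> is a right inverse.\<close>
      then have fe: "f (e k) = ?y"
        using fin by (auto simp: f_def e_def if_distrib[of "\<lambda>x. _ * x"] cong: if_cong)
      have "(A \<star>\<^bsub>I\<^esub> (G \<star>\<^bsub>I\<^esub> A)) i k = (\<Sum>j\<in>J. A i j * (\<Sum>l\<in>J. g (e l) j * A l k))"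
        by (simp add: einstein_prod_def G_def J_def)
      also have "\<dots> = f (g ?y) i"
        by (simp add: f_def expand[OF y])
      also have "\<dots> = A i k" using fg[of "e k"] by (simp add: fe)
      finally show ?thesis .
    qed
  qed
  moreover have "G \<in> tensors I" by (auto simp: tensors_def G_def J_def)
  ultimately show ?thesis using that by (simp add: prod_assoc)
qed

section \<open>Hermitian positive definite tensors\<close>

lemma diagonal_off_diagonal: "diagonal_tensor I D \<Longrightarrow> i \<noteq> j \<Longrightarrow> D i j = 0"
  unfolding diagonal_tensor_def tensors_def by blast

lemma diagonal_prod:
  assumes "diagonal_tensor I D" and "i \<in> multi_index I"
  shows "(D \<star>\<^bsub>I\<^esub> W) i k = D i i * W i k"
proof -
  have "(D \<star>\<^bsub>I\<^esub> W) i k = (\<Sum>j\<in>multi_index I. if j = i then D i i * W i k else 0)"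
    unfolding einstein_prod_def using assms
    by (intro sum.cong) (auto simp: diagonal_tensor_def)
  then show ?thesis using assms by (simp add: finite_multi_index)
qed

lemma hermitian_pos_def_in_tensors: "hermitian_pos_def I P \<Longrightarrow> P \<in> tensors I"
  by (auto simp: hermitian_pos_def_def unitary_tensor_def diagonal_tensor_def)

lemma hermitian_pos_def_conj_transpose:
  assumes "hermitian_pos_def I P"
  shows "P\<^sup>H = P"
proof -
  from assms obtain U D where D: "diagonal_tensor I D" "\<forall>i\<in>multi_index I. D i i \<in> \<real>"
    and P: "P = U \<star>\<^bsub>I\<^esub> D \<star>\<^bsub>I\<^esub> U\<^sup>H"
    unfolding hermitian_pos_def_def by blast
  have "(D\<^sup>H) i j = D i j" for i j
  proof (cases "i = j \<and> i \<in> multi_index I")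
    case True
    then show ?thesis using D by (auto simp: conj_transpose_def Reals_cnj_iff)
  next
    case False
    then have "D i j = 0 \<and> D j i = 0"
      using D(1) diagonal_off_diagonal[OF D(1)] by (cases "i = j") (auto simp: diagonal_tensor_def tensors_def)
    then show ?thesis by (simp add: conj_transpose_def)
  qed
  then have "D\<^sup>H = D" by (intro ext)
  then show ?thesis by (simp add: P conj_transpose_prod prod_assoc)
qed

text \<open>Inverting the diagonal entries in the spectral form gives \<open>R\<close>. Its diagonal
  is again positive, so \<open>R\<close> can itself serve as a weight.\<close>

lemma hermitian_pos_def_inverse:
  assumes "hermitian_pos_def I P"
  obtains R where "hermitian_pos_def I R" "P \<star>\<^bsub>I\<^esub> R = id_tensor I" "R \<star>\<^bsub>I\<^esub> P = id_tensor I"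
proof -
  from assms obtain U D where U: "unitary_tensor I U" and D: "diagonal_tensor I D"
    and pos: "\<forall>i\<in>multi_index I. D i i \<in> \<real> \<and> 0 < Re (D i i)"
    and P: "P = U \<star>\<^bsub>I\<^esub> D \<star>\<^bsub>I\<^esub> U\<^sup>H"
    unfolding hermitian_pos_def_def by blast
  define D' where "D' = (\<lambda>i j. if i = j \<and> i \<in> multi_index I then inverse (D i i) else 0)"
  have D': "diagonal_tensor I D'" by (auto simp: diagonal_tensor_def tensors_def D'_def)
  have T: "U \<in> tensors I" "U\<^sup>H \<in> tensors I" "D \<in> tensors I" "D' \<in> tensors I"
    using U D D' by (auto simp: unitary_tensor_def diagonal_tensor_def)
  have UU: "U \<star>\<^bsub>I\<^esub> U\<^sup>H = id_tensor I" "U\<^sup>H \<star>\<^bsub>I\<^esub> U = id_tensor I"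
    using U by (auto simp: unitary_tensor_def)
  have pos': "D' i i \<in> \<real> \<and> 0 < Re (D' i i)" if i: "i \<in> multi_index I" for i
  proof -
    from pos i obtain r where "D i i = of_real r" "0 < r" by (metis Reals_cases Re_complex_of_real)
    then show ?thesis using i by (simp add: D'_def flip: of_real_inverse)
  qed
  have nz: "D i i \<noteq> 0" if "i \<in> multi_index I" for i using pos that by force
  have DD: "(D \<star>\<^bsub>I\<^esub> D') i j = id_tensor I i j" "(D' \<star>\<^bsub>I\<^esub> D) i j = id_tensor I i j" for i j
  proof -
    consider "i \<in> multi_index I" | "i \<notin> multi_index I" by blast
    then have "(D \<star>\<^bsub>I\<^esub> D') i j = id_tensor I i j \<and> (D' \<star>\<^bsub>I\<^esub> D) i j = id_tensor I i j"
    proof cases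
      case 1
      moreover have "D' i i * D i j = id_tensor I i j" "D i i * D' i j = id_tensor I i j"
        using nz[OF 1] 1 diagonal_off_diagonal[OF D, of i j] by (auto simp: D'_def id_tensor_eq)
      ultimately show ?thesis
        by (simp add: diagonal_prod[OF D] diagonal_prod[OF D'])
    next
      case 2
      then show ?thesis
        using T by (auto simp: einstein_prod_def tensors_def id_tensor_eq)
    qed
    then show "(D \<star>\<^bsub>I\<^esub> D') i j = id_tensor I i j" "(D' \<star>\<^bsub>I\<^esub> D) i j = id_tensor I i j" by auto
  qed
  then have DD': "D \<star>\<^bsub>I\<^esub> D' = id_tensor I" "D' \<star>\<^bsub>I\<^esub> D = id_tensor I" by (intro ext, simp)+
  \<comment> \<open>With general \<open>E\<close> and \<open>F\<close> this yields both
    \<open>P R\<close> and \<open>R P\<close>.\<close>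
  have conj: "(U \<star>\<^bsub>I\<^esub> E \<star>\<^bsub>I\<^esub> U\<^sup>H) \<star>\<^bsub>I\<^esub> (U \<star>\<^bsub>I\<^esub> F \<star>\<^bsub>I\<^esub> U\<^sup>H) = id_tensor I"
    if "E \<star>\<^bsub>I\<^esub> F = id_tensor I" "F \<in> tensors I" for E F
  proof -
    have "(U \<star>\<^bsub>I\<^esub> E \<star>\<^bsub>I\<^esub> U\<^sup>H) \<star>\<^bsub>I\<^esub> (U \<star>\<^bsub>I\<^esub> F \<star>\<^bsub>I\<^esub> U\<^sup>H)
        = U \<star>\<^bsub>I\<^esub> (E \<star>\<^bsub>I\<^esub> ((U\<^sup>H \<star>\<^bsub>I\<^esub> U) \<star>\<^bsub>I\<^esub> F) \<star>\<^bsub>I\<^esub> U\<^sup>H)"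
      by (simp add: prod_assoc)
    also have "\<dots> = id_tensor I" using that T by (simp add: UU id_prod)
    finally show ?thesis .
  qed
  show ?thesis
  proof (rule that)
    show "hermitian_pos_def I (U \<star>\<^bsub>I\<^esub> D' \<star>\<^bsub>I\<^esub> U\<^sup>H)"
      unfolding hermitian_pos_def_def using U D' pos' by blast
  qed (simp_all add: P conj DD' T)
qed

lemma hermitian_pos_def_cancel_left:
  assumes "hermitian_pos_def I P" "A \<in> tensors I" "B \<in> tensors I" "P \<star>\<^bsub>I\<^esub> A = P \<star>\<^bsub>I\<^esub> B"
  shows "A = B"
proof -
  obtain R where R: "R \<star>\<^bsub>I\<^esub> P = id_tensor I" using assms(1) by (rule hermitian_pos_def_inverse)
  have "R \<star>\<^bsub>I\<^esub> P \<star>\<^bsub>I\<^esub> A = R \<star>\<^bsub>I\<^esub> P \<star>\<^bsub>I\<^esub> B" using assms(4) by (simp add: prod_assoc)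
  then show ?thesis using assms by (simp add: R id_prod)
qed

text \<open>With \<open>W = U\<^sup>H Z\<close> the hypothesis reads
  \<open>W\<^sup>H D W = 0\<close>. Its diagonal entry at \<open>k\<close> is the sum over
  \<open>j\<close> of \<open>D j j\<close> times the squared modulus of \<open>W j k\<close>, so
  every term vanishes, and \<open>Z = U W\<close> is zero.\<close>

lemma hermitian_pos_def_definite:
  assumes P: "hermitian_pos_def I P" and Z: "Z \<in> tensors I" and zero: "Z\<^sup>H \<star>\<^bsub>I\<^esub> P \<star>\<^bsub>I\<^esub> Z = 0"
  shows "Z = 0"
proof -
  from P obtain U D where U: "unitary_tensor I U" and D: "diagonal_tensor I D"
    and pos: "\<forall>i\<in>multi_index I. D i i \<in> \<real> \<and> 0 < Re (D i i)"
    and P: "P = U \<star>\<^bsub>I\<^esub> D \<star>\<^bsub>I\<^esub> U\<^sup>H"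
    unfolding hermitian_pos_def_def by blast
  define W where "W = U\<^sup>H \<star>\<^bsub>I\<^esub> Z"
  have WDW: "W\<^sup>H \<star>\<^bsub>I\<^esub> (D \<star>\<^bsub>I\<^esub> W) = 0"
    using zero by (simp add: W_def P conj_transpose_prod prod_assoc)
  have W0: "W j k = 0" if j: "j \<in> multi_index I" for j k
  proof -
    have "0 = (W\<^sup>H \<star>\<^bsub>I\<^esub> (D \<star>\<^bsub>I\<^esub> W)) k k" by (simp add: WDW)
    also have "\<dots> = (\<Sum>j\<in>multi_index I. cnj (W j k) * (D j j * W j k))"
      unfolding einstein_prod_def[of I "W\<^sup>H"]
      by (intro sum.cong) (auto simp: diagonal_prod[OF D] conj_transpose_def)
    also have "\<dots> = (\<Sum>j\<in>multi_index I. of_real (Re (D j j) * (cmod (W j k))\<^sup>2))"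
    proof (intro sum.cong refl)
      fix j assume "j \<in> multi_index I"
      with pos obtain d where d: "D j j = of_real d" by (meson Reals_cases)
      show "cnj (W j k) * (D j j * W j k) = of_real (Re (D j j) * (cmod (W j k))\<^sup>2)"
        using complex_norm_square[of "W j k"] by (simp add: d mult_ac)
    qed
    finally have "(\<Sum>j\<in>multi_index I. Re (D j j) * (cmod (W j k))\<^sup>2) = 0"
      by (simp only: of_real_sum[symmetric] of_real_eq_0_iff[symmetric, where 'a = complex])
    then have "\<forall>j\<in>multi_index I. Re (D j j) * (cmod (W j k))\<^sup>2 = 0"
      using pos by (subst (asm) sum_nonneg_eq_0_iff) (auto simp: finite_multi_index less_imp_le)
    then show ?thesis using pos j by (metis less_irrefl mult_eq_0_iff power_eq_0_iff norm_eq_zero)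
  qed
  have "Z = U \<star>\<^bsub>I\<^esub> U\<^sup>H \<star>\<^bsub>I\<^esub> Z" using U Z by (simp add: unitary_tensor_def id_prod)
  also have "\<dots> = U \<star>\<^bsub>I\<^esub> W" by (simp add: W_def prod_assoc)
  also have "\<dots> = 0" by (auto simp: einstein_prod_def fun_eq_iff W0)
  finally show ?thesis .
qed

section \<open>Adjoints with respect to a weight\<close>

text \<open>For the form \<open>x\<^sup>H W y\<close> this says that \<open>T\<close> on the left
  argument acts as \<open>S\<close> on the right one. As a relation it avoids an explicit inverse of
  \<open>W\<close>.\<close>

definition weighted_adjoint :: "nat list \<Rightarrow> ctensor \<Rightarrow> ctensor \<Rightarrow> ctensor \<Rightarrow> bool" where
  "weighted_adjoint I W T S \<longleftrightarrow> W \<star>\<^bsub>I\<^esub> S = T\<^sup>H \<star>\<^bsub>I\<^esub> W"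

lemma weighted_adjoint_prod:
  assumes "weighted_adjoint I W T S" "weighted_adjoint I W T' S'"
  shows "weighted_adjoint I W (T \<star>\<^bsub>I\<^esub> T') (S' \<star>\<^bsub>I\<^esub> S)"
  using assms unfolding weighted_adjoint_def conj_transpose_prod by (metis prod_assoc)

lemma weighted_adjoint_sym:
  assumes "W\<^sup>H = W" "weighted_adjoint I W T S"
  shows "weighted_adjoint I W S T"
  using assms unfolding weighted_adjoint_def by (metis conj_transpose_prod conj_transpose_conj_transpose)

lemma weighted_adjoint_unique:
  assumes "hermitian_pos_def I W" "weighted_adjoint I W T S" "weighted_adjoint I W T S'"
    "S \<in> tensors I" "S' \<in> tensors I"
  shows "S = S'"
  using assms hermitian_pos_def_cancel_left unfolding weighted_adjoint_def by metis

text \<open>Since the weights are Hermitian, \<open>(M A X)\<^sup>H = (A X)\<^sup>H M\<close>, and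
  likewise for \<open>N\<close>; the last two Penrose equations thus become selfadjointness.\<close>

lemma is_wmp_inverse_iff:
  assumes "hermitian_pos_def I M" "hermitian_pos_def I N"
  shows "is_wmp_inverse I M N A X \<longleftrightarrow> X \<in> tensors I \<and> A \<star>\<^bsub>I\<^esub> X \<star>\<^bsub>I\<^esub> A = A \<and> X \<star>\<^bsub>I\<^esub> A \<star>\<^bsub>I\<^esub> X = X
    \<and> weighted_adjoint I M (A \<star>\<^bsub>I\<^esub> X) (A \<star>\<^bsub>I\<^esub> X) \<and> weighted_adjoint I N (X \<star>\<^bsub>I\<^esub> A) (X \<star>\<^bsub>I\<^esub> A)"
  unfolding is_wmp_inverse_def weighted_adjoint_def
  using assms[THEN hermitian_pos_def_conj_transpose]
  by (simp add: conj_transpose_prod prod_assoc eq_commute)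

section \<open>Existence and uniqueness of the weighted Moore--Penrose inverse\<close>

text \<open>This is weighted least squares: \<open>S = A\<^sup>H P A\<close> is the Gram tensor, and
  definiteness of \<open>P\<close> lets identities for \<open>S\<close> be lifted to
  \<open>A\<close>.\<close>

lemma inner_inverse_right_selfadjoint:
  assumes P: "hermitian_pos_def I P" and A: "A \<in> tensors I"
  obtains Y where "Y \<in> tensors I" "A \<star>\<^bsub>I\<^esub> Y \<star>\<^bsub>I\<^esub> A = A" "(P \<star>\<^bsub>I\<^esub> A \<star>\<^bsub>I\<^esub> Y)\<^sup>H = P \<star>\<^bsub>I\<^esub> A \<star>\<^bsub>I\<^esub> Y"
proof -
  note PT = hermitian_pos_def_in_tensors[OF P] and PH = hermitian_pos_def_conj_transpose[OF P]
  define S where "S = A\<^sup>H \<star>\<^bsub>I\<^esub> P \<star>\<^bsub>I\<^esub> A"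
  have S: "S \<in> tensors I" "S\<^sup>H = S"
    using A PT by (auto simp: S_def PH conj_transpose_prod prod_assoc)
  from S(1) obtain G where G: "G \<in> tensors I" "S \<star>\<^bsub>I\<^esub> G \<star>\<^bsub>I\<^esub> S = S"
    by (rule inner_inverse_exists)
  \<comment> \<open>The difference is \<open>?Z = A (K S - 1)\<close>, and
    \<open>A\<^sup>H P ?Z = S K S - S = 0\<close>. Hence \<open>?Z\<^sup>H P ?Z = 0\<close>, and
    definiteness applies. The claim is for arbitrary \<open>K\<close> because both \<open>G\<close>
    and \<open>G\<^sup>H\<close> are substituted.\<close>
  have cancel: "A \<star>\<^bsub>I\<^esub> K \<star>\<^bsub>I\<^esub> S = A" if K: "K \<in> tensors I" "S \<star>\<^bsub>I\<^esub> K \<star>\<^bsub>I\<^esub> S = S" for K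
  proof -
    let ?Z = "A \<star>\<^bsub>I\<^esub> K \<star>\<^bsub>I\<^esub> S - A"
    have Z: "?Z = A \<star>\<^bsub>I\<^esub> (K \<star>\<^bsub>I\<^esub> S - id_tensor I)"
      using A by (simp add: prod_diff_right prod_id prod_assoc)
    have "?Z\<^sup>H \<star>\<^bsub>I\<^esub> P \<star>\<^bsub>I\<^esub> ?Z = (K \<star>\<^bsub>I\<^esub> S - id_tensor I)\<^sup>H \<star>\<^bsub>I\<^esub> (A\<^sup>H \<star>\<^bsub>I\<^esub> P \<star>\<^bsub>I\<^esub> ?Z)"
      by (subst Z) (simp add: conj_transpose_prod prod_assoc)
    also have "A\<^sup>H \<star>\<^bsub>I\<^esub> P \<star>\<^bsub>I\<^esub> ?Z = S \<star>\<^bsub>I\<^esub> K \<star>\<^bsub>I\<^esub> S - S"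
      by (simp only: prod_diff_right) (simp add: S_def prod_assoc)
    also have "\<dots> = 0" using K by simp
    also have "(K \<star>\<^bsub>I\<^esub> S - id_tensor I)\<^sup>H \<star>\<^bsub>I\<^esub> 0 = 0" by (simp add: einstein_prod_def fun_eq_iff)
    finally have "?Z = 0"
      by (rule hermitian_pos_def_definite[OF P, rotated])
        (intro diff_in_tensors prod_in_tensors A K(1) S(1))
    then show ?thesis by simp
  qed
  define Y where "Y = G \<star>\<^bsub>I\<^esub> A\<^sup>H \<star>\<^bsub>I\<^esub> P"
  have YT: "Y \<in> tensors I" using G A PT by (auto simp: Y_def)
  have AYA: "A \<star>\<^bsub>I\<^esub> Y \<star>\<^bsub>I\<^esub> A = A" using cancel[OF G] by (simp add: Y_def S_def prod_assoc)
  \<comment> \<open>\<open>G\<close> may fail to be Hermitian, but \<open>S\<close> is Hermitian, so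
    \<open>G\<^sup>H\<close> is an inner inverse too. The adjoint of its cancellation law is
    \<open>S G A\<^sup>H = A\<^sup>H\<close>.\<close>
  have "S \<star>\<^bsub>I\<^esub> G\<^sup>H \<star>\<^bsub>I\<^esub> S = S"
    using arg_cong[OF G(2), of conj_transpose] by (simp add: conj_transpose_prod S prod_assoc)
  from cancel[OF _ this] G have "A \<star>\<^bsub>I\<^esub> G\<^sup>H \<star>\<^bsub>I\<^esub> S = A" by auto
  from arg_cong[OF this, of conj_transpose] have SG: "S \<star>\<^bsub>I\<^esub> (G \<star>\<^bsub>I\<^esub> A\<^sup>H) = A\<^sup>H"
    by (simp add: conj_transpose_prod S)
  \<comment> \<open>Symmetry of \<open>P A Y\<close> is obtained by rewriting its conjugate
    transpose as \<open>Y\<^sup>H S Y\<close>, which is visibly Hermitian.\<close>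
  have "Y\<^sup>H \<star>\<^bsub>I\<^esub> S \<star>\<^bsub>I\<^esub> Y = Y\<^sup>H \<star>\<^bsub>I\<^esub> (S \<star>\<^bsub>I\<^esub> (G \<star>\<^bsub>I\<^esub> A\<^sup>H)) \<star>\<^bsub>I\<^esub> P"
    by (simp add: Y_def prod_assoc)
  also have "\<dots> = (P \<star>\<^bsub>I\<^esub> A \<star>\<^bsub>I\<^esub> Y)\<^sup>H" by (simp add: SG conj_transpose_prod PH prod_assoc)
  finally have eq: "Y\<^sup>H \<star>\<^bsub>I\<^esub> S \<star>\<^bsub>I\<^esub> Y = (P \<star>\<^bsub>I\<^esub> A \<star>\<^bsub>I\<^esub> Y)\<^sup>H" .
  have "(Y\<^sup>H \<star>\<^bsub>I\<^esub> S \<star>\<^bsub>I\<^esub> Y)\<^sup>H = Y\<^sup>H \<star>\<^bsub>I\<^esub> S \<star>\<^bsub>I\<^esub> Y"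
    by (simp add: conj_transpose_prod S prod_assoc)
  then have "(P \<star>\<^bsub>I\<^esub> A \<star>\<^bsub>I\<^esub> Y)\<^sup>H = P \<star>\<^bsub>I\<^esub> A \<star>\<^bsub>I\<^esub> Y"
    unfolding eq conj_transpose_conj_transpose by (rule sym)
  with YT AYA show ?thesis by (rule that)
qed

text \<open>Dualise: apply the right-sided version to \<open>A\<^sup>H\<close> with weight
  \<open>R\<close>, the inverse of \<open>N\<close>, to obtain \<open>V\<close>; then
  \<open>Z = V\<^sup>H\<close>.\<close>

lemma inner_inverse_left_selfadjoint:
  assumes N: "hermitian_pos_def I N" and A: "A \<in> tensors I"
  obtains Z where "Z \<in> tensors I" "A \<star>\<^bsub>I\<^esub> Z \<star>\<^bsub>I\<^esub> A = A" "(N \<star>\<^bsub>I\<^esub> Z \<star>\<^bsub>I\<^esub> A)\<^sup>H = N \<star>\<^bsub>I\<^esub> Z \<star>\<^bsub>I\<^esub> A"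
proof -
  obtain R where R: "hermitian_pos_def I R" "N \<star>\<^bsub>I\<^esub> R = id_tensor I" "R \<star>\<^bsub>I\<^esub> N = id_tensor I"
    using N by (rule hermitian_pos_def_inverse)
  obtain V where V: "V \<in> tensors I" "A\<^sup>H \<star>\<^bsub>I\<^esub> V \<star>\<^bsub>I\<^esub> A\<^sup>H = A\<^sup>H"
    and RV: "(R \<star>\<^bsub>I\<^esub> A\<^sup>H \<star>\<^bsub>I\<^esub> V)\<^sup>H = R \<star>\<^bsub>I\<^esub> A\<^sup>H \<star>\<^bsub>I\<^esub> V"
    using inner_inverse_right_selfadjoint[OF R(1) conj_transpose_in_tensors[OF A]] by metis
  note H = R(1)[THEN hermitian_pos_def_conj_transpose] N[THEN hermitian_pos_def_conj_transpose]
  have T: "A\<^sup>H \<star>\<^bsub>I\<^esub> V \<star>\<^bsub>I\<^esub> N \<in> tensors I" "V\<^sup>H \<star>\<^bsub>I\<^esub> A \<in> tensors I"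
    using A V hermitian_pos_def_in_tensors[OF N] by auto
  \<comment> \<open>Multiplying the Hermitian tensor \<open>R A\<^sup>H V\<close> by
    \<open>N\<close> on both sides turns its symmetry into
    \<open>A\<^sup>H V N = N V\<^sup>H A\<close>.\<close>
  have "A\<^sup>H \<star>\<^bsub>I\<^esub> V \<star>\<^bsub>I\<^esub> N = N \<star>\<^bsub>I\<^esub> R \<star>\<^bsub>I\<^esub> (A\<^sup>H \<star>\<^bsub>I\<^esub> V \<star>\<^bsub>I\<^esub> N)" using T by (simp add: R id_prod)
  also have "\<dots> = N \<star>\<^bsub>I\<^esub> (R \<star>\<^bsub>I\<^esub> A\<^sup>H \<star>\<^bsub>I\<^esub> V) \<star>\<^bsub>I\<^esub> N" by (simp add: prod_assoc)
  also have "\<dots> = N \<star>\<^bsub>I\<^esub> (R \<star>\<^bsub>I\<^esub> A\<^sup>H \<star>\<^bsub>I\<^esub> V)\<^sup>H \<star>\<^bsub>I\<^esub> N" by (simp only: RV)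
  also have "\<dots> = N \<star>\<^bsub>I\<^esub> ((V\<^sup>H \<star>\<^bsub>I\<^esub> A) \<star>\<^bsub>I\<^esub> (R \<star>\<^bsub>I\<^esub> N))"
    by (simp add: conj_transpose_prod H prod_assoc)
  also have "\<dots> = N \<star>\<^bsub>I\<^esub> V\<^sup>H \<star>\<^bsub>I\<^esub> A"
    by (simp only: R prod_id[OF T(2)]) (simp add: prod_assoc)
  finally have "(N \<star>\<^bsub>I\<^esub> V\<^sup>H \<star>\<^bsub>I\<^esub> A)\<^sup>H = N \<star>\<^bsub>I\<^esub> V\<^sup>H \<star>\<^bsub>I\<^esub> A"
    by (simp add: conj_transpose_prod H prod_assoc)
  moreover have "A \<star>\<^bsub>I\<^esub> V\<^sup>H \<star>\<^bsub>I\<^esub> A = A"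
    using arg_cong[OF V(2), of conj_transpose] by (simp add: conj_transpose_prod prod_assoc)
  ultimately show ?thesis using that V(1) by blast
qed

text \<open>For \<open>X = Z A Y\<close> the products collapse to \<open>A X = A Y\<close> and
  \<open>X A = Z A\<close>, so \<open>X\<close> inherits one symmetry from each factor.\<close>

lemma wmp_inverse_exists:
  assumes M: "hermitian_pos_def I M" and N: "hermitian_pos_def I N" and A: "A \<in> tensors I"
  shows "\<exists>X. is_wmp_inverse I M N A X"
proof -
  obtain Y where Y: "Y \<in> tensors I" "A \<star>\<^bsub>I\<^esub> Y \<star>\<^bsub>I\<^esub> A = A" "(M \<star>\<^bsub>I\<^esub> A \<star>\<^bsub>I\<^esub> Y)\<^sup>H = M \<star>\<^bsub>I\<^esub> A \<star>\<^bsub>I\<^esub> Y"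
    using M A by (rule inner_inverse_right_selfadjoint)
  obtain Z where Z: "Z \<in> tensors I" "A \<star>\<^bsub>I\<^esub> Z \<star>\<^bsub>I\<^esub> A = A" "(N \<star>\<^bsub>I\<^esub> Z \<star>\<^bsub>I\<^esub> A)\<^sup>H = N \<star>\<^bsub>I\<^esub> Z \<star>\<^bsub>I\<^esub> A"
    using N A by (rule inner_inverse_left_selfadjoint)
  define X where "X = Z \<star>\<^bsub>I\<^esub> A \<star>\<^bsub>I\<^esub> Y"
  have AX: "A \<star>\<^bsub>I\<^esub> X = A \<star>\<^bsub>I\<^esub> Y" by (simp add: X_def Z(2) flip: prod_assoc)
  have XA: "X \<star>\<^bsub>I\<^esub> A = Z \<star>\<^bsub>I\<^esub> A" by (simp add: X_def Y(2)[unfolded prod_assoc] prod_assoc)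
  have "A \<star>\<^bsub>I\<^esub> X \<star>\<^bsub>I\<^esub> A = A" using AX Y(2) by simp
  moreover have "X \<star>\<^bsub>I\<^esub> A \<star>\<^bsub>I\<^esub> X = X" 
    unfolding XA by (simp add: prod_assoc AX) (simp add: X_def prod_assoc)
  moreover have "X \<in> tensors I" using Y Z A by (auto simp: X_def)
  moreover have "M \<star>\<^bsub>I\<^esub> A \<star>\<^bsub>I\<^esub> X = M \<star>\<^bsub>I\<^esub> A \<star>\<^bsub>I\<^esub> Y" "N \<star>\<^bsub>I\<^esub> X \<star>\<^bsub>I\<^esub> A = N \<star>\<^bsub>I\<^esub> Z \<star>\<^bsub>I\<^esub> A"
    by (simp_all add: prod_assoc AX XA)
  ultimately have "is_wmp_inverse I M N A X"
    unfolding is_wmp_inverse_def by (simp only: Y(3) Z(3))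
  then show ?thesis by (rule exI[of _ X])
qed

text \<open>\<open>F E\<close> is an adjoint of \<open>E F = F\<close>, and so is \<open>F\<close>;
  adjoints are unique.\<close>

lemma selfadjoint_absorb:
  assumes W: "hermitian_pos_def I W" and T: "E \<in> tensors I" "F \<in> tensors I"
    and E: "weighted_adjoint I W E E" and F: "weighted_adjoint I W F F" and EF: "E \<star>\<^bsub>I\<^esub> F = F"
  shows "F \<star>\<^bsub>I\<^esub> E = F"
  using weighted_adjoint_prod[OF E F] unfolding EF
  by (rule weighted_adjoint_unique[OF W _ F]) (use T in auto)

text \<open>\<open>A X\<close> and \<open>A Y\<close> are \<open>M\<close>-selfadjoint projections
  with the same range, hence equal; \<open>X A\<close> and \<open>Y A\<close> are
  \<open>N\<close>-selfadjoint projections with the same kernel, hence equal. Then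
  \<open>X = X A X = Y A Y = Y\<close>.\<close>

lemma wmp_inverse_unique:
  assumes M: "hermitian_pos_def I M" and N: "hermitian_pos_def I N" and A: "A \<in> tensors I"
    and X: "is_wmp_inverse I M N A X" and Y: "is_wmp_inverse I M N A Y"
  shows "X = Y"
proof -
  have X': "X \<in> tensors I" "A \<star>\<^bsub>I\<^esub> X \<star>\<^bsub>I\<^esub> A = A" "X \<star>\<^bsub>I\<^esub> A \<star>\<^bsub>I\<^esub> X = X"
    "weighted_adjoint I M (A \<star>\<^bsub>I\<^esub> X) (A \<star>\<^bsub>I\<^esub> X)" "weighted_adjoint I N (X \<star>\<^bsub>I\<^esub> A) (X \<star>\<^bsub>I\<^esub> A)"
    using X by (auto simp: is_wmp_inverse_iff[OF M N])
  have Y': "Y \<in> tensors I" "A \<star>\<^bsub>I\<^esub> Y \<star>\<^bsub>I\<^esub> A = A" "Y \<star>\<^bsub>I\<^esub> A \<star>\<^bsub>I\<^esub> Y = Y"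
    "weighted_adjoint I M (A \<star>\<^bsub>I\<^esub> Y) (A \<star>\<^bsub>I\<^esub> Y)" "weighted_adjoint I N (Y \<star>\<^bsub>I\<^esub> A) (Y \<star>\<^bsub>I\<^esub> A)"
    using Y by (auto simp: is_wmp_inverse_iff[OF M N])
  have "A \<star>\<^bsub>I\<^esub> X \<star>\<^bsub>I\<^esub> (A \<star>\<^bsub>I\<^esub> Y) = A \<star>\<^bsub>I\<^esub> Y" by (simp add: X'(2) flip: prod_assoc)
  with X'(4) Y'(4) have "A \<star>\<^bsub>I\<^esub> Y \<star>\<^bsub>I\<^esub> (A \<star>\<^bsub>I\<^esub> X) = A \<star>\<^bsub>I\<^esub> Y"
    by (rule selfadjoint_absorb[OF M prod_in_tensors[OF A X'(1)] prod_in_tensors[OF A Y'(1)]])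
  moreover have "A \<star>\<^bsub>I\<^esub> Y \<star>\<^bsub>I\<^esub> (A \<star>\<^bsub>I\<^esub> X) = A \<star>\<^bsub>I\<^esub> X" by (simp add: Y'(2) flip: prod_assoc)
  ultimately have AX: "A \<star>\<^bsub>I\<^esub> X = A \<star>\<^bsub>I\<^esub> Y" by simp
  \<comment> \<open>The adjoint of \<open>X A Y A = X A\<close> is \<open>Y A X A\<close>, which
    reduces to \<open>Y A\<close>; so \<open>X A\<close> has both itself and \<open>Y A\<close> as
    adjoints.\<close>
  have "X \<star>\<^bsub>I\<^esub> A \<star>\<^bsub>I\<^esub> (Y \<star>\<^bsub>I\<^esub> A) = X \<star>\<^bsub>I\<^esub> A" by (simp add: Y'(2)[unfolded prod_assoc] prod_assoc)
  with weighted_adjoint_prod[OF X'(5) Y'(5)]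
  have "weighted_adjoint I N (X \<star>\<^bsub>I\<^esub> A) (Y \<star>\<^bsub>I\<^esub> A \<star>\<^bsub>I\<^esub> (X \<star>\<^bsub>I\<^esub> A))" by simp
  moreover have "Y \<star>\<^bsub>I\<^esub> A \<star>\<^bsub>I\<^esub> (X \<star>\<^bsub>I\<^esub> A) = Y \<star>\<^bsub>I\<^esub> A" by (simp add: X'(2)[unfolded prod_assoc] prod_assoc)
  ultimately have "weighted_adjoint I N (X \<star>\<^bsub>I\<^esub> A) (Y \<star>\<^bsub>I\<^esub> A)" by simp
  with X'(5) have XA: "X \<star>\<^bsub>I\<^esub> A = Y \<star>\<^bsub>I\<^esub> A"
    by (rule weighted_adjoint_unique[OF N]) (intro prod_in_tensors A X'(1) Y'(1))+
  have "X = X \<star>\<^bsub>I\<^esub> A \<star>\<^bsub>I\<^esub> X" using X' by simp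
  also have "\<dots> = Y \<star>\<^bsub>I\<^esub> A \<star>\<^bsub>I\<^esub> Y" by (simp add: XA) (simp add: AX prod_assoc)
  also have "\<dots> = Y" using Y' by simp
  finally show ?thesis .
qed

lemma wmp_inverse_eqI:
  assumes "hermitian_pos_def I M" "hermitian_pos_def I N" "A \<in> tensors I" "is_wmp_inverse I M N A X"
  shows "wmp_inverse I M N A = X"
  unfolding wmp_inverse_def using assms by (blast intro: the_equality wmp_inverse_unique)

lemma is_wmp_inverse_wmp_inverse:
  assumes "hermitian_pos_def I M" "hermitian_pos_def I N" "A \<in> tensors I"
  shows "is_wmp_inverse I M N A (wmp_inverse I M N A)"
  using wmp_inverse_exists[OF assms] wmp_inverse_eqI[OF assms] by blast

section \<open>The reverse order law\<close>

theorem theorem4p6: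
  fixes I :: "nat list" and A B M N :: ctensor
  assumes "length I \<ge> 1" and "\<forall>k<length I. I ! k \<ge> 1"
    and "A \<in> tensors I" and "B \<in> tensors I" and "M \<in> tensors I" and "N \<in> tensors I"
    and "hermitian_pos_def I M" and "hermitian_pos_def I N"
    and "M \<star>\<^bsub>I\<^esub> wmp_inverse I M N A = (M \<star>\<^bsub>I\<^esub> A)\<^sup>H"
    and "N \<star>\<^bsub>I\<^esub> wmp_inverse I M N B = (N \<star>\<^bsub>I\<^esub> B)\<^sup>H"
    and "A \<star>\<^bsub>I\<^esub> (B \<star>\<^bsub>I\<^esub> wmp_inverse I M N B) = (B \<star>\<^bsub>I\<^esub> wmp_inverse I M N B) \<star>\<^bsub>I\<^esub> A
       \<or> wmp_inverse I M N A \<star>\<^bsub>I\<^esub> (B \<star>\<^bsub>I\<^esub> wmp_inverse I M N B)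
           = (B \<star>\<^bsub>I\<^esub> wmp_inverse I M N B) \<star>\<^bsub>I\<^esub> wmp_inverse I M N A
       \<or> B \<star>\<^bsub>I\<^esub> (wmp_inverse I M N A \<star>\<^bsub>I\<^esub> A) = (wmp_inverse I M N A \<star>\<^bsub>I\<^esub> A) \<star>\<^bsub>I\<^esub> B
       \<or> wmp_inverse I M N B \<star>\<^bsub>I\<^esub> (wmp_inverse I M N A \<star>\<^bsub>I\<^esub> A)
           = (wmp_inverse I M N A \<star>\<^bsub>I\<^esub> A) \<star>\<^bsub>I\<^esub> wmp_inverse I M N B"
  shows "wmp_inverse I M N (A \<star>\<^bsub>I\<^esub> B) = wmp_inverse I M N B \<star>\<^bsub>I\<^esub> wmp_inverse I M N A"
proof -
  note M = assms(7) and N = assms(8) and T = assms(3-6)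
  note MH = hermitian_pos_def_conj_transpose[OF M] and NH = hermitian_pos_def_conj_transpose[OF N]
  define X where "X = wmp_inverse I M N A"
  define Y where "Y = wmp_inverse I M N B"
  define P where "P = X \<star>\<^bsub>I\<^esub> A"
  define Q where "Q = B \<star>\<^bsub>I\<^esub> Y"
  have X: "X \<in> tensors I" "A \<star>\<^bsub>I\<^esub> P = A" "P \<star>\<^bsub>I\<^esub> X = X" "weighted_adjoint I N P P"
    using is_wmp_inverse_wmp_inverse[OF M N T(1)]
    by (auto simp: is_wmp_inverse_iff[OF M N] X_def P_def prod_assoc)
  have Y: "Y \<in> tensors I" "Q \<star>\<^bsub>I\<^esub> B = B" "Y \<star>\<^bsub>I\<^esub> Q = Y" "weighted_adjoint I M Q Q"
    using is_wmp_inverse_wmp_inverse[OF M N T(2)]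
    by (auto simp: is_wmp_inverse_iff[OF M N] Y_def Q_def prod_assoc)
  have PQ_T: "P \<in> tensors I" "Q \<in> tensors I" using T X Y by (auto simp: P_def Q_def)
  have adjA: "weighted_adjoint I M A X"
    using assms(9) by (simp add: weighted_adjoint_def X_def conj_transpose_prod MH)
  have adjB: "weighted_adjoint I N B Y"
    using assms(10) by (simp add: weighted_adjoint_def Y_def conj_transpose_prod NH)
  note adjX = weighted_adjoint_sym[OF MH adjA] and adjY = weighted_adjoint_sym[OF NH adjB]
  \<comment> \<open>Move \<open>Q\<close> through the factors of \<open>P = X A\<close> one at a
    time; \<open>from_Y\<close> does the same with \<open>P\<close> and
    \<open>Q = B Y\<close>.\<close>
  have from_X: "P \<star>\<^bsub>I\<^esub> Q = Q \<star>\<^bsub>I\<^esub> P"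
    if "A \<star>\<^bsub>I\<^esub> Q = Q \<star>\<^bsub>I\<^esub> A" "X \<star>\<^bsub>I\<^esub> Q = Q \<star>\<^bsub>I\<^esub> X"
    using that by (metis P_def prod_assoc)
  have from_Y: "P \<star>\<^bsub>I\<^esub> Q = Q \<star>\<^bsub>I\<^esub> P"
    if "B \<star>\<^bsub>I\<^esub> P = P \<star>\<^bsub>I\<^esub> B" "Y \<star>\<^bsub>I\<^esub> P = P \<star>\<^bsub>I\<^esub> Y"
    using that by (metis Q_def prod_assoc)
  \<comment> \<open>Taking adjoints of \<open>C E = E C\<close> with \<open>E\<close> selfadjoint
    gives \<open>E S = S E\<close>. It supplies the missing half of each pair: weight
    \<open>M\<close> for \<open>A\<close> and \<open>X\<close>, weight \<open>N\<close> for
    \<open>B\<close> and \<open>Y\<close>.\<close>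
  have adj_commute: "S \<star>\<^bsub>I\<^esub> E = E \<star>\<^bsub>I\<^esub> S"
    if "hermitian_pos_def I W" "weighted_adjoint I W C S" "weighted_adjoint I W E E"
      "C \<star>\<^bsub>I\<^esub> E = E \<star>\<^bsub>I\<^esub> C" "S \<in> tensors I" "E \<in> tensors I" for W C S E
    using that weighted_adjoint_prod[OF that(2,3)] weighted_adjoint_prod[OF that(3,2)]
    by (intro weighted_adjoint_unique[OF that(1), of "C \<star>\<^bsub>I\<^esub> E"]) auto
  have PQ: "P \<star>\<^bsub>I\<^esub> Q = Q \<star>\<^bsub>I\<^esub> P"
    using assms(11)[folded X_def Y_def, folded P_def Q_def]
  proof (elim disjE)
    assume "A \<star>\<^bsub>I\<^esub> Q = Q \<star>\<^bsub>I\<^esub> A"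
    with adj_commute[OF M adjA Y(4)] X PQ_T show ?thesis by (intro from_X)
  next
    assume "X \<star>\<^bsub>I\<^esub> Q = Q \<star>\<^bsub>I\<^esub> X"
    with adj_commute[OF M adjX Y(4)] T PQ_T show ?thesis by (intro from_X)
  next
    assume "B \<star>\<^bsub>I\<^esub> P = P \<star>\<^bsub>I\<^esub> B"
    with adj_commute[OF N adjB X(4)] Y PQ_T show ?thesis by (intro from_Y)
  next
    assume "Y \<star>\<^bsub>I\<^esub> P = P \<star>\<^bsub>I\<^esub> Y"
    with adj_commute[OF N adjY X(4)] T PQ_T show ?thesis by (intro from_Y)
  qed
  have l: "A \<star>\<^bsub>I\<^esub> B \<star>\<^bsub>I\<^esub> (Y \<star>\<^bsub>I\<^esub> X) = A \<star>\<^bsub>I\<^esub> Q \<star>\<^bsub>I\<^esub> X" by (simp add: Q_def prod_assoc)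
  have r: "Y \<star>\<^bsub>I\<^esub> X \<star>\<^bsub>I\<^esub> (A \<star>\<^bsub>I\<^esub> B) = Y \<star>\<^bsub>I\<^esub> P \<star>\<^bsub>I\<^esub> B" by (simp add: P_def prod_assoc)
  \<comment> \<open>Swapping \<open>Q P\<close> to \<open>P Q\<close> lets \<open>A\<close> absorb
    \<open>P\<close> and \<open>B\<close> absorb \<open>Q\<close>.\<close>
  have "A \<star>\<^bsub>I\<^esub> Q \<star>\<^bsub>I\<^esub> X \<star>\<^bsub>I\<^esub> (A \<star>\<^bsub>I\<^esub> B) = A \<star>\<^bsub>I\<^esub> (Q \<star>\<^bsub>I\<^esub> P) \<star>\<^bsub>I\<^esub> B" by (simp add: P_def prod_assoc)
  also have "\<dots> = (A \<star>\<^bsub>I\<^esub> P) \<star>\<^bsub>I\<^esub> (Q \<star>\<^bsub>I\<^esub> B)" by (simp only: PQ[symmetric] prod_assoc)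
  also have "\<dots> = A \<star>\<^bsub>I\<^esub> B" by (simp only: X Y)
  finally have one: "A \<star>\<^bsub>I\<^esub> Q \<star>\<^bsub>I\<^esub> X \<star>\<^bsub>I\<^esub> (A \<star>\<^bsub>I\<^esub> B) = A \<star>\<^bsub>I\<^esub> B" .
  have "Y \<star>\<^bsub>I\<^esub> P \<star>\<^bsub>I\<^esub> B \<star>\<^bsub>I\<^esub> (Y \<star>\<^bsub>I\<^esub> X) = Y \<star>\<^bsub>I\<^esub> (P \<star>\<^bsub>I\<^esub> Q) \<star>\<^bsub>I\<^esub> X" by (simp add: Q_def prod_assoc)
  also have "\<dots> = (Y \<star>\<^bsub>I\<^esub> Q) \<star>\<^bsub>I\<^esub> (P \<star>\<^bsub>I\<^esub> X)" by (simp only: PQ prod_assoc)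
  also have "\<dots> = Y \<star>\<^bsub>I\<^esub> X" by (simp only: X Y)
  finally have two: "Y \<star>\<^bsub>I\<^esub> P \<star>\<^bsub>I\<^esub> B \<star>\<^bsub>I\<^esub> (Y \<star>\<^bsub>I\<^esub> X) = Y \<star>\<^bsub>I\<^esub> X" .
  \<comment> \<open>The adjoint reverses the factors and exchanges \<open>A\<close> with
    \<open>X\<close> while fixing \<open>Q\<close>, so \<open>A Q X\<close> is mapped to itself; the
    next fact is the same for \<open>Y P B\<close>.\<close>
  have three: "weighted_adjoint I M (A \<star>\<^bsub>I\<^esub> Q \<star>\<^bsub>I\<^esub> X) (A \<star>\<^bsub>I\<^esub> Q \<star>\<^bsub>I\<^esub> X)"
    using weighted_adjoint_prod[OF weighted_adjoint_prod[OF adjA Y(4)] adjX] by (simp add: prod_assoc)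
  have four: "weighted_adjoint I N (Y \<star>\<^bsub>I\<^esub> P \<star>\<^bsub>I\<^esub> B) (Y \<star>\<^bsub>I\<^esub> P \<star>\<^bsub>I\<^esub> B)"
    using weighted_adjoint_prod[OF weighted_adjoint_prod[OF adjY X(4)] adjB] by (simp add: prod_assoc)
  have "is_wmp_inverse I M N (A \<star>\<^bsub>I\<^esub> B) (Y \<star>\<^bsub>I\<^esub> X)"
    using X(1) Y(1) one two three four by (auto simp: is_wmp_inverse_iff[OF M N] l r)
  then show ?thesis
    unfolding X_def[symmetric] Y_def[symmetric] using T by (intro wmp_inverse_eqI[OF M N]) auto
qed

end
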